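(* Let $m\ge 3$ and $1\le r\le n$ be integers. Let $\mathcal S$ be a real symmetric tensor of order $m$ and dimension $n$ for which there exist orthonormal vectors $\mathbf u_1,\dots,\mathbf u_r\in\mathbb R^n$ and real numbers $\lambda_1,\dots,\lambda_r>0$ such that $\mathcal S=\sum_{i=1}^r\lambda_i\,\mathbf u_i^{\circ m}$. Then the number of all eigenpairs of $\mathcal S$, counted as equivalence classes over $\mathbb C$, is $\dfrac{(m-1)^r-1}{m-2}$.
   Context: For a vector $\mathbf a\in\mathbb R^n$, $\mathbf a^{\circ m}$ denotes the order-$m$ symmetric tensor with entries $(\mathbf a^{\circ m})_{i_1,\dots,i_m}=a_{i_1}\cdots a_{i_m}$. For a real symmetric tensor $\mathcal S=(s_{i_1,\dots,i_m})_{1\le i_1,\dots,i_m\le n}$ and $\mathbf u\in\mathbb C^n$, $\mathcal S\mathbf u^{m-1}$ is the vector with $j$th entry $\sum_{i_2,\dots,i_m=1}^n s_{j,i_2,\dots,i_m}u_{i_2}\cdots u_{i_m}$. An eigenpair (over $\mathbb C$) is a pair $(\lambda,\mathbf u)$ with $\lambda\in\mathbb C$, $\mathbf u\in\mathbb C^n\setminus\{0\}$ and $\mathcal S\mathbf u^{m-1}=\lambda\mathbf u$. If $(\lambda,\mathbf u)$ is an eigenpair then so is $(t^{m-2}\lambda,t\mathbf u)$ for every $t\in\mathbb C\setminus\{0\}$; the equivalence class of $(\lambda,\mathbf u)$ is $[(\lambda,\mathbf u)]=\{(t^{m-2}\lambda,t\mathbf u): t\in\mathbb C\setminus\{0\}\}$,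 and eigenpairs are counted up to this equivalence.
   Formalization: The printed count fails for r < n, since vectors orthogonal to all u_i are eigenvectors with eigenvalue 0 (e.g. m=3, n=2, S=e_1^{∘3} has 2 classes, not 1); the formula is proved for classes with nonzero eigenvalue for all r, and for all classes when r = n. *)

theory Defs
  imports "HOL-Analysis.Analysis" "HOL-Library.Multiset"
begin

text \<open>
  A tensor of order \<open>m\<close> and dimension \<open>CARD('n)\<close> is given by its entries
  \<open>S [i\<^sub>1, \<dots>, i\<^sub>m]\<close>, indexed by lists of length \<open>m\<close>. The values of \<open>S\<close> on lists of any
  other length are irrelevant, and nothing below depends on them.
\<close>

type_synonym 'n tensor = "'n list \<Rightarrow> real"

definition symmetric_tensor :: "nat \<Rightarrow> 'n tensor \<Rightarrow> bool" where
  "symmetric_tensor m S \<longleftrightarrow>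
     (\<forall>xs ys. length xs = m \<longrightarrow> mset ys = mset xs \<longrightarrow> S ys = S xs)"

text \<open>The entries of \<open>a\<^sup>\<circ>\<^sup>m\<close> for every \<open>m\<close> at once: the order is the length of the index list.\<close>

definition tensor_power :: "real ^ 'n \<Rightarrow> 'n tensor" where
  "tensor_power a is = (\<Prod>i\<leftarrow>is. a $ i)"

definition tensor_apply :: "nat \<Rightarrow> 'n::finite tensor \<Rightarrow> complex ^ 'n \<Rightarrow> complex ^ 'n" where
  "tensor_apply m S u =
     (\<chi> j. \<Sum>is | length is = m - 1. complex_of_real (S (j # is)) * (\<Prod>i\<leftarrow>is. u $ i))"

text \<open>The eigenvalue \<open>0\<close> is allowed.\<close>

definition eigenpair :: "nat \<Rightarrow> 'n::finite tensor \<Rightarrow> complex \<Rightarrow> complex ^ 'n \<Rightarrow> bool" where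
  "eigenpair m S l u \<longleftrightarrow> u \<noteq> 0 \<and> tensor_apply m S u = l *s u"

definition eigenpair_class :: "nat \<Rightarrow> complex \<Rightarrow> complex ^ 'n \<Rightarrow> (complex \<times> (complex ^ 'n)) set" where
  "eigenpair_class m l u = {(t ^ (m - 2) * l, t *s u) | t. t \<noteq> 0}"

definition eigenpair_classes :: "nat \<Rightarrow> 'n::finite tensor \<Rightarrow> (complex \<times> (complex ^ 'n)) set set" where
  "eigenpair_classes m S = {eigenpair_class m l u | l u. eigenpair m S l u}"

text \<open>
  The classes with nonzero eigenvalue; every pair in a class has nonzero eigenvalue as soon as
  one has. They have to be separated from the rest: if \<open>S\<close> is a combination of the powers of \<open>r\<close>
  orthonormal vectors and \<open>r < CARD('n)\<close>, then each nonzero complex vector orthogonal to all of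
  them is an eigenvector with eigenvalue \<open>0\<close>, so that there is one further class for
  \<open>r = CARD('n) - 1\<close> and there are infinitely many further classes for \<open>r < CARD('n) - 1\<close>.
\<close>

definition nonzero_eigenpair_classes ::
    "nat \<Rightarrow> 'n::finite tensor \<Rightarrow> (complex \<times> (complex ^ 'n)) set set" where
  "nonzero_eigenpair_classes m S =
     {eigenpair_class m l u | l u. eigenpair m S l u \<and> l \<noteq> 0}"

end

theory Submission
  imports Defs
begin

text \<open>
  In the coordinates \<open>a\<^sub>i = \<langle>u\<^sub>i, v\<rangle>\<close> the eigenvalue equation decouples into
  \<open>\<lambda>\<^sub>i a\<^sub>i\<^bsup>m-1\<^esup> = l a\<^sub>i\<close>, and \<open>v\<close> lies in the span of the \<open>u\<^sub>i\<close> when \<open>l \<noteq> 0\<close>. Every class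
  with nonzero eigenvalue can be rescaled to \<open>l = 1\<close>, where each \<open>a\<^sub>i\<close> is either \<open>0\<close> or one of
  the \<open>m - 2\<close> roots of \<open>a\<^bsup>m-2\<^esup> = 1 / \<lambda>\<^sub>i\<close>; this gives \<open>(m - 1)\<^sup>r - 1\<close> nonzero vectors. Each
  class contains exactly \<open>m - 2\<close> of them, namely the multiples of one vector by the
  \<open>(m - 2)\<close>-th roots of unity.
\<close>

section \<open>Coordinates and the contraction of power tensors\<close>

text \<open>Distributivity, by splitting each index list into head and tail. With
  \<open>f k = a $ k * v $ k\<close> it turns the contraction of a power tensor with
  \<open>v\<close> into a power of one coordinate.\<close>

lemma sum_prod_list_eq_power:
  fixes f :: "'n::finite \<Rightarrow> 'a::comm_semiring_1"
  shows "(\<Sum>is | length is = N. \<Prod>i\<leftarrow>is. f i) = (\<Sum>i\<in>UNIV. f i) ^ N"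
proof (induction N)
  case 0
  show ?case by simp
next
  case (Suc N)
  have "bij_betw (\<lambda>(i, is). i # is) (UNIV \<times> {is :: 'n list. length is = N})
      {is. length is = Suc N}"
    by (rule bij_betw_byWitness[where f' = "\<lambda>is. (hd is, tl is)"])
      (auto simp: length_Suc_conv)
  then have "(\<Sum>is | length is = Suc N. \<Prod>i\<leftarrow>is. f i)
      = (\<Sum>(i, is) \<in> UNIV \<times> {is. length is = N}. f i * (\<Prod>i\<leftarrow>is. f i))"
    by (subst sum.reindex_bij_betw[symmetric], assumption) (simp add: case_prod_unfold)
  also have "\<dots> = (\<Sum>i\<in>UNIV. f i) ^ Suc N"
    by (simp add: sum.cartesian_product[symmetric] sum_product[symmetric] Suc.IH)
  finally show ?case .
qed

definition complexify :: "real ^ 'n \<Rightarrow> complex ^ 'n" where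
  "complexify a = (\<chi> j. complex_of_real (a $ j))"

text \<open>The complex-linear extension of the inner product with a real vector; no conjugation
  arises, so its powers stay polynomial in \<open>v\<close>.\<close>

definition coordinate :: "real ^ 'n::finite \<Rightarrow> complex ^ 'n \<Rightarrow> complex" where
  "coordinate a v = (\<Sum>j\<in>UNIV. complex_of_real (a $ j) * v $ j)"

lemma coordinate_scale: "coordinate a (c *s v) = c * coordinate a v"
  by (simp add: coordinate_def sum_distrib_left mult_ac)

lemma coordinate_sum: "coordinate a (\<Sum>i\<in>I. f i) = (\<Sum>i\<in>I. coordinate a (f i))"
  unfolding coordinate_def by (simp add: sum_distrib_left sum.swap[of _ I])

lemma coordinate_complexify: "coordinate a (complexify b) = complex_of_real (a \<bullet> b)"
  by (simp add: coordinate_def complexify_def inner_vec_def)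

lemma coordinate_orthonormal_combination:
  fixes u :: "nat \<Rightarrow> real ^ 'n::finite"
  assumes "\<And>i j. i < r \<Longrightarrow> j < r \<Longrightarrow> u i \<bullet> u j = (if i = j then 1 else 0)"
    and "j < r"
  shows "coordinate (u j) (\<Sum>i<r. a i *s complexify (u i)) = a j"
proof -
  have "coordinate (u j) (\<Sum>i<r. a i *s complexify (u i)) = (\<Sum>i<r. if j = i then a i else 0)"
    unfolding coordinate_sum coordinate_scale coordinate_complexify
    using assms by (intro sum.cong) auto
  with assms(2) show ?thesis by simp
qed

text \<open>As many orthonormal vectors as the dimension span the real space, so a real vector
  orthogonal to all of them is orthogonal to itself.\<close>

lemma coordinates_zero_imp_zero:
  fixes u :: "nat \<Rightarrow> real ^ 'n::finite"
  assumes orth: "\<And>i j. i < CARD('n) \<Longrightarrow> j < CARD('n) \<Longrightarrow>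
      u i \<bullet> u j = (if i = j then 1 else 0)"
    and zero: "\<And>i. i < CARD('n) \<Longrightarrow> coordinate (u i) v = 0"
  shows "v = 0"
proof -
  let ?B = "u ` {..<CARD('n)}"
  have inj: "inj_on u {..<CARD('n)}"
    by (intro inj_onI) (metis orth lessThan_iff zero_neq_one)
  have "0 \<notin> ?B" using orth by fastforce
  moreover have "pairwise orthogonal ?B"
    using orth by (auto simp: pairwise_def orthogonal_def)
  ultimately have indep: "independent ?B"
    using pairwise_orthogonal_independent by blast
  have span: "span ?B = UNIV"
    using card_ge_dim_independent[of ?B UNIV, OF _ indep] inj by (auto simp: card_image)
  have *: "w = 0" if "\<And>i. i < CARD('n) \<Longrightarrow> u i \<bullet> w = 0" for w :: "real ^ 'n"
  proof -
    have "orthogonal w w"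
      by (rule orthogonal_to_span[of _ ?B])
        (use span that in \<open>auto simp: orthogonal_def inner_commute\<close>)
    then show ?thesis by (simp add: orthogonal_self)
  qed
  \<comment> \<open>The \<open>u i\<close> are real, so real and imaginary parts of \<open>v\<close>
    can be treated separately.\<close>
  have "(\<chi> j. Re (v $ j)) = 0"
    by (rule *) (use zero in \<open>auto simp: coordinate_def inner_vec_def complex_eq_iff\<close>)
  moreover have "(\<chi> j. Im (v $ j)) = 0"
    by (rule *) (use zero in \<open>auto simp: coordinate_def inner_vec_def complex_eq_iff\<close>)
  ultimately show ?thesis
    by (simp add: vec_eq_iff complex_eq_iff)
qed

text \<open>Filling \<open>m - 1\<close> slots of a rank-one power with \<open>v\<close> leaves a
  scalar times the vector in the free slot. This is what decouples the eigenvalue equation.\<close>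

lemma tensor_apply_sum_tensor_power:
  fixes S :: "'n::finite tensor"
  assumes "m \<ge> 1"
    and rep: "\<And>is. length is = m \<Longrightarrow> S is = (\<Sum>i<r. lam i * tensor_power (u i) is)"
  shows "tensor_apply m S v
    = (\<Sum>i<r. (complex_of_real (lam i) * coordinate (u i) v ^ (m - 1)) *s complexify (u i))"
proof (rule vec_eq_iff[THEN iffD2, rule_format])
  fix j
  have prod_real: "complex_of_real (\<Prod>k\<leftarrow>ks. a $ k) * (\<Prod>k\<leftarrow>ks. v $ k)
      = (\<Prod>k\<leftarrow>ks. complex_of_real (a $ k) * v $ k)" for a :: "real ^ 'n" and ks
    by (induction ks) (simp_all add: mult_ac)
  have "tensor_apply m S v $ j
    = (\<Sum>is | length is = m - 1. \<Sum>i<r. complex_of_real (lam i * u i $ j) *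
        (\<Prod>k\<leftarrow>is. complex_of_real (u i $ k) * v $ k))"
    unfolding tensor_apply_def using assms(1)
    by (auto intro!: sum.cong
        simp: rep tensor_power_def sum_distrib_right mult.assoc simp flip: prod_real)
  also have "\<dots> = (\<Sum>i<r. complex_of_real (lam i * u i $ j) * coordinate (u i) v ^ (m - 1))"
    by (subst sum.swap)
      (simp add: sum_distrib_left[symmetric] sum_prod_list_eq_power coordinate_def)
  finally show "tensor_apply m S v $ j = (\<Sum>i<r. (complex_of_real (lam i) *
      coordinate (u i) v ^ (m - 1)) *s complexify (u i)) $ j"
    by (simp add: complexify_def mult_ac)
qed

section \<open>Equivalence classes and rescaling to eigenvalue one\<close>

lemma mem_eigenpair_class_self: "(l, v) \<in> eigenpair_class m l v"
  by (auto simp: eigenpair_class_def intro!: exI[of _ 1])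

lemma eigenpair_class_scale:
  assumes "t \<noteq> 0"
  shows "eigenpair_class m (t ^ (m - 2) * l) (t *s v) = eigenpair_class m l v"
proof (intro equalityI subsetI)
  fix p assume "p \<in> eigenpair_class m (t ^ (m - 2) * l) (t *s v)"
  then obtain s where "s \<noteq> 0" "p = (s ^ (m - 2) * (t ^ (m - 2) * l), s *s (t *s v))"
    by (auto simp: eigenpair_class_def)
  with assms show "p \<in> eigenpair_class m l v"
    by (auto simp: eigenpair_class_def power_mult_distrib mult_ac intro!: exI[of _ "s * t"])
next
  fix p assume "p \<in> eigenpair_class m l v"
  then obtain s where "s \<noteq> 0" "p = (s ^ (m - 2) * l, s *s v)"
    by (auto simp: eigenpair_class_def)
  with assms show "p \<in> eigenpair_class m (t ^ (m - 2) * l) (t *s v)"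
    by (auto simp: eigenpair_class_def power_divide intro!: exI[of _ "s / t"])
qed

text \<open>Keeping the eigenvalue at one forces the scalar to be a root of unity. The conjunct
  \<open>z \<noteq> 0\<close> matters for \<open>m \<le> 2\<close>, where \<open>z ^ (m - 2)\<close>
  is \<open>z ^ 0 = 1\<close>.\<close>

lemma eigenpair_class_one_eq_iff:
  "eigenpair_class m 1 w = eigenpair_class m 1 v
    \<longleftrightarrow> (\<exists>z. z \<noteq> 0 \<and> z ^ (m - 2) = 1 \<and> w = z *s v)"
proof
  assume "eigenpair_class m 1 w = eigenpair_class m 1 v"
  then have "(1, w) \<in> eigenpair_class m 1 v"
    using mem_eigenpair_class_self by metis
  then show "\<exists>z. z \<noteq> 0 \<and> z ^ (m - 2) = 1 \<and> w = z *s v"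
    by (auto simp: eigenpair_class_def)
next
  assume "\<exists>z. z \<noteq> 0 \<and> z ^ (m - 2) = 1 \<and> w = z *s v"
  then show "eigenpair_class m 1 w = eigenpair_class m 1 v"
    using eigenpair_class_scale[of _ m 1 v] by force
qed

lemma tensor_apply_scale: "tensor_apply m S (t *s v) = t ^ (m - 1) *s tensor_apply m S v"
proof -
  have "(\<Prod>k\<leftarrow>ks. t * v $ k) = t ^ length ks * (\<Prod>k\<leftarrow>ks. v $ k)" for ks
    by (induction ks) (simp_all add: mult_ac)
  then show ?thesis
    by (simp add: tensor_apply_def vec_eq_iff sum_distrib_left mult_ac)
qed

lemma eigenpair_scale:
  assumes "m \<ge> 2" "t \<noteq> 0" "eigenpair m S l v"
  shows "eigenpair m S (t ^ (m - 2) * l) (t *s v)"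
proof -
  \<comment> \<open>One of the \<open>m - 1\<close> factors stays with the vector, the others go to
    the eigenvalue.\<close>
  have "t ^ (m - 1) = t ^ (m - 2) * t"
    using assms(1) by (subst power_Suc2[symmetric]) (simp add: Suc_diff_le[symmetric])
  with assms show ?thesis
    by (auto simp: eigenpair_def tensor_apply_scale mult_ac)
qed

lemma nonzero_eigenpair_classes_eq_image:
  assumes "m \<ge> 3"
  shows "nonzero_eigenpair_classes m S = eigenpair_class m 1 ` {v. eigenpair m S 1 v}"
proof (intro equalityI subsetI)
  fix c assume "c \<in> nonzero_eigenpair_classes m S"
  then obtain l v where c: "c = eigenpair_class m l v" and e: "eigenpair m S l v" and "l \<noteq> 0"
    by (auto simp: nonzero_eigenpair_classes_def)
  \<comment> \<open>The set has \<open>m - 2 > 0\<close> elements; any of them rescales the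
    eigenvalue to one.\<close>
  have "{z::complex. z ^ (m - 2) = 1 / l} \<noteq> {}"
    using card_nth_roots[of "1 / l" "m - 2"] \<open>l \<noteq> 0\<close> assms by force
  then obtain t where t: "t ^ (m - 2) = 1 / l" by blast
  with \<open>l \<noteq> 0\<close> assms have "t \<noteq> 0" by (auto simp: power_0_left)
  have "t ^ (m - 2) * l = 1" using t \<open>l \<noteq> 0\<close> by simp
  then have "c = eigenpair_class m 1 (t *s v)" "eigenpair m S 1 (t *s v)"
    using eigenpair_class_scale[OF \<open>t \<noteq> 0\<close>, of m l v] eigenpair_scale[OF _ \<open>t \<noteq> 0\<close> e] assms c
    by auto
  then show "c \<in> eigenpair_class m 1 ` {v. eigenpair m S 1 v}" by blast
qed (force simp: nonzero_eigenpair_classes_def)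

text \<open>The roots of unity act freely on nonzero vectors, so all fibres of the map from
  unit-eigenvalue vectors to classes have size \<open>m - 2\<close>.\<close>

lemma card_unit_eigenvectors_eq:
  assumes "m \<ge> 3" and fin: "finite {v. eigenpair m S 1 v}"
  shows "card {v. eigenpair m S 1 v} = (m - 2) * card (nonzero_eigenpair_classes m S)"
proof -
  let ?X = "{v. eigenpair m S 1 v}"
  have fibre: "card {w \<in> ?X. eigenpair_class m 1 w = eigenpair_class m 1 v} = m - 2"
    if "v \<in> ?X" for v
  proof -
    from that have "v \<noteq> 0" by (simp add: eigenpair_def)
    then have inj: "inj_on (\<lambda>z. z *s v) {z. z ^ (m - 2) = 1}"
      by (auto simp: inj_on_def)
    have "{w \<in> ?X. eigenpair_class m 1 w = eigenpair_class m 1 v}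
        = (\<lambda>z. z *s v) ` {z. z ^ (m - 2) = 1}"
    proof (intro equalityI subsetI)
      fix w assume "w \<in> (\<lambda>z. z *s v) ` {z. z ^ (m - 2) = 1}"
      then obtain z where z: "z ^ (m - 2) = 1" "w = z *s v" by blast
      with assms(1) have "z \<noteq> 0" by (auto simp: power_0_left)
      with z that eigenpair_scale[of m z S 1 v] assms(1)
      show "w \<in> {w \<in> ?X. eigenpair_class m 1 w = eigenpair_class m 1 v}"
        by (auto simp: eigenpair_class_one_eq_iff)
    qed (auto simp: eigenpair_class_one_eq_iff)
    then show ?thesis
      using card_image[OF inj] card_roots_unity_eq[of "m - 2"] assms(1) by simp
  qed
  have "card ?X = (\<Sum>c\<in>eigenpair_class m 1 ` ?X. card {w \<in> ?X. eigenpair_class m 1 w = c})"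
    using sum.image_gen[OF fin, of "\<lambda>_. 1::nat" "eigenpair_class m 1"] by simp
  also have "\<dots> = (\<Sum>c\<in>eigenpair_class m 1 ` ?X. m - 2)"
    using fibre by (intro sum.cong) auto
  finally show ?thesis
    by (simp add: nonzero_eigenpair_classes_eq_image[OF assms(1)])
qed

section \<open>Counting the eigenvectors with eigenvalue one\<close>

lemma card_unit_eigenvectors:
  fixes S :: "'n::finite tensor"
  assumes m: "m \<ge> 3"
    and orth: "\<And>i j. i < r \<Longrightarrow> j < r \<Longrightarrow> u i \<bullet> u j = (if i = j then 1 else 0)"
    and pos: "\<And>i. i < r \<Longrightarrow> lam i > 0"
    and rep: "\<And>is. length is = m \<Longrightarrow> S is = (\<Sum>i<r. lam i * tensor_power (u i) is)"
  shows "finite {v. eigenpair m S 1 v}" and "card {v. eigenpair m S 1 v} = (m - 1) ^ r - 1"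
proof -
  define A where "A i = insert 0 {z::complex. z ^ (m - 2) = 1 / complex_of_real (lam i)}" for i
  define comb where "comb a = (\<Sum>i<r. a i *s complexify (u i))" for a
  \<comment> \<open>Extensional families make the coefficients of a vector unique as functions; the
    removed family is the one that gives the zero vector.\<close>
  define T where "T = PiE {..<r} A - {\<lambda>i\<in>{..<r}. 0}"
  have A_iff: "a \<in> A i \<longleftrightarrow> complex_of_real (lam i) * a ^ (m - 1) = a" if "i < r" for a i
  proof -
    have "a ^ (m - 1) = a * a ^ (m - 2)"
      using m by (subst power_Suc[symmetric]) (simp add: Suc_diff_le[symmetric])
    with pos[OF that] show ?thesis by (auto simp: A_def field_simps)
  qed
  have cA: "finite (A i)" "card (A i) = m - 1" if "i < r" for i
  proof -
    have "card {z::complex. z ^ (m - 2) = 1 / complex_of_real (lam i)} = m - 2"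
      using pos[OF that] m by (intro card_nth_roots) auto
    \<comment> \<open>Infinite sets have \<open>card\<close> zero, so a positive cardinality yields
      finiteness.\<close>
    moreover from this m have "finite {z::complex. z ^ (m - 2) = 1 / complex_of_real (lam i)}"
      by (intro card_ge_0_finite) simp
    ultimately show "finite (A i)" "card (A i) = m - 1"
      using m pos[OF that] by (auto simp: A_def card_insert_if power_0_left)
  qed
  have coord_comb: "coordinate (u i) (comb a) = a i" if "i < r" for i a
    unfolding comb_def using orth that by (rule coordinate_orthonormal_combination)
  have eigen_iff: "eigenpair m S 1 v \<longleftrightarrow> v \<noteq> 0 \<and>
      comb (\<lambda>i. complex_of_real (lam i) * coordinate (u i) v ^ (m - 1)) = v" for v
    using m by (simp add: eigenpair_def comb_def tensor_apply_sum_tensor_power[OF _ rep])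
  have comb_cong: "comb a = comb b" if "\<And>i. i < r \<Longrightarrow> a i = b i" for a b
    unfolding comb_def using that by (intro sum.cong) auto
  have comb0: "comb (\<lambda>i. 0) = 0" by (simp add: comb_def)
  have coord0: "coordinate a 0 = 0" for a :: "real ^ 'n" by (simp add: coordinate_def)
  have recover: "(\<lambda>i\<in>{..<r}. coordinate (u i) (comb a)) = a" if "a \<in> extensional {..<r}" for a
    using that by (auto simp: fun_eq_iff coord_comb extensional_def)
  have bij: "bij_betw comb T {v. eigenpair m S 1 v}"
  proof (rule bij_betw_byWitness[where f' = "\<lambda>v. \<lambda>i\<in>{..<r}. coordinate (u i) v"])
    show "\<forall>a\<in>T. (\<lambda>i\<in>{..<r}. coordinate (u i) (comb a)) = a"
      using recover by (auto simp: T_def PiE_def)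
    \<comment> \<open>Take the \<open>i\<close>-th coordinate of both sides of the fixed-point
      equation in \<open>eigen_iff\<close>.\<close>
    have coords: "complex_of_real (lam i) * coordinate (u i) v ^ (m - 1) = coordinate (u i) v"
      if "eigenpair m S 1 v" "i < r" for v i
      using that coord_comb by (metis (no_types, lifting) eigen_iff)
    \<comment> \<open>The fixed-point equation itself writes \<open>v\<close> as a combination of
      the \<open>u i\<close>, even if they do not span the whole space.\<close>
    have comb_coords: "comb (\<lambda>i\<in>{..<r}. coordinate (u i) v) = v" if "eigenpair m S 1 v" for v
    proof -
      have "comb (\<lambda>i\<in>{..<r}. coordinate (u i) v)
          = comb (\<lambda>i. complex_of_real (lam i) * coordinate (u i) v ^ (m - 1))"
        using coords[OF that] by (intro comb_cong) simp
      with that show ?thesis by (simp add: eigen_iff)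
    qed
    then show "\<forall>v\<in>{v. eigenpair m S 1 v}. comb (\<lambda>i\<in>{..<r}. coordinate (u i) v) = v" by simp
    show "comb ` T \<subseteq> {v. eigenpair m S 1 v}"
    proof clarify
      fix a assume a: "a \<in> T"
      \<comment> \<open>Otherwise \<open>recover\<close> would make \<open>a\<close> the zero
        family, which \<open>T\<close> excludes.\<close>
      have "comb a \<noteq> 0"
        using a recover[of a] coord0 by (auto simp: T_def PiE_def)
      moreover have "comb (\<lambda>i. complex_of_real (lam i) * coordinate (u i) (comb a) ^ (m - 1))
          = comb a"
        using a by (intro comb_cong) (metis A_iff DiffD1 PiE_mem T_def coord_comb lessThan_iff)
      ultimately show "eigenpair m S 1 (comb a)" by (simp add: eigen_iff)
    qed
    show "(\<lambda>v. \<lambda>i\<in>{..<r}. coordinate (u i) v) ` {v. eigenpair m S 1 v} \<subseteq> T"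
    proof clarify
      fix v assume v: "eigenpair m S 1 v"
      have "(\<lambda>i\<in>{..<r}. coordinate (u i) v) \<noteq> (\<lambda>i\<in>{..<r}. 0)"
      proof
        assume "(\<lambda>i\<in>{..<r}. coordinate (u i) v) = (\<lambda>i\<in>{..<r}. 0)"
        then have "v = comb (\<lambda>i\<in>{..<r}. 0)" using comb_coords[OF v] by simp
        also have "\<dots> = 0" using comb_cong[of "\<lambda>i\<in>{..<r}. 0" "\<lambda>i. 0"] comb0 by simp
        finally show False using v by (simp add: eigenpair_def)
      qed
      then show "(\<lambda>i\<in>{..<r}. coordinate (u i) v) \<in> T"
        using coords[OF v] by (auto simp: T_def A_iff)
    qed
  qed
  have "finite (PiE {..<r} A)" using cA by (intro finite_PiE) auto
  moreover have "(\<lambda>i\<in>{..<r}. 0) \<in> PiE {..<r} A" by (auto simp: A_def)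
  moreover have "card (PiE {..<r} A) = (m - 1) ^ r" using cA by (simp add: card_PiE)
  ultimately have "finite T" "card T = (m - 1) ^ r - 1" by (simp_all add: T_def)
  then show "finite {v. eigenpair m S 1 v}" "card {v. eigenpair m S 1 v} = (m - 1) ^ r - 1"
    using bij_betw_finite[OF bij] bij_betw_same_card[OF bij] by simp_all
qed

section \<open>Eigenvalue zero for a full orthonormal basis, and the final count\<close>

text \<open>Eigenvalue zero makes each \<open>lam i\<close> times a positive power of the
  \<open>i\<close>-th coordinate vanish, so every coordinate in a full basis is zero.\<close>

lemma not_eigenpair_zero:
  fixes S :: "'n::finite tensor"
  assumes "m \<ge> 2"
    and orth: "\<And>i j. i < CARD('n) \<Longrightarrow> j < CARD('n) \<Longrightarrow> u i \<bullet> u j = (if i = j then 1 else 0)"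
    and pos: "\<And>i. i < CARD('n) \<Longrightarrow> lam i > 0"
    and rep: "\<And>is. length is = m \<Longrightarrow> S is = (\<Sum>i<CARD('n). lam i * tensor_power (u i) is)"
  shows "\<not> eigenpair m S 0 v"
proof
  assume e: "eigenpair m S 0 v"
  have "coordinate (u i) v = 0" if "i < CARD('n)" for i
  proof -
    have "complex_of_real (lam i) * coordinate (u i) v ^ (m - 1)
        = coordinate (u i) (tensor_apply m S v)"
      using assms(1) coordinate_orthonormal_combination[OF orth that]
      by (subst tensor_apply_sum_tensor_power[OF _ rep]) auto
    also have "\<dots> = 0" using e by (simp add: eigenpair_def coordinate_def)
    finally show ?thesis using pos[OF that] by auto
  qed
  then have "v = 0" using coordinates_zero_imp_zero[OF orth] by blast
  with e show False by (simp add: eigenpair_def)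
qed

theorem lemma3:
  fixes m r :: nat
    and S :: "'n::finite tensor"
    and u :: "nat \<Rightarrow> real ^ 'n"
    and lam :: "nat \<Rightarrow> real"
  assumes "m \<ge> 3" and "1 \<le> r" and "r \<le> CARD('n)"
    and "symmetric_tensor m S"
    and "\<And>i j. i < r \<Longrightarrow> j < r \<Longrightarrow> u i \<bullet> u j = (if i = j then 1 else 0)"
    and "\<And>i. i < r \<Longrightarrow> lam i > 0"
    and "\<And>is. length is = m \<Longrightarrow> S is = (\<Sum>i<r. lam i * tensor_power (u i) is)"
  shows "real (card (nonzero_eigenpair_classes m S)) = ((real m - 1) ^ r - 1) / (real m - 2) \<and>
    (r = CARD('n) \<longrightarrow>
      real (card (eigenpair_classes m S)) = ((real m - 1) ^ r - 1) / (real m - 2))"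
proof (intro conjI impI)
  note unit = card_unit_eigenvectors[of m r u lam S, OF assms(1,5,6,7)]
  have "(m - 2) * card (nonzero_eigenpair_classes m S) = (m - 1) ^ r - 1"
    using card_unit_eigenvectors_eq[OF assms(1) unit(1)] unit(2) by simp
  then have "real (m - 2) * real (card (nonzero_eigenpair_classes m S)) = real ((m - 1) ^ r - 1)"
    by (metis of_nat_mult)
  \<comment> \<open>This lets the truncated subtraction of \<open>1\<close> carry over to the
    reals.\<close>
  moreover have "(m - 1) ^ r \<ge> 1" using assms(1) by simp
  ultimately show count:
    "real (card (nonzero_eigenpair_classes m S)) = ((real m - 1) ^ r - 1) / (real m - 2)"
    using assms(1) by (simp add: of_nat_diff field_simps)
  assume r: "r = CARD('n)"
  have "\<not> eigenpair m S 0 v" for v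
    using assms(1) not_eigenpair_zero[of m u lam S v] assms(5,6,7) unfolding r by simp
  then have "eigenpair_classes m S = nonzero_eigenpair_classes m S"
    unfolding eigenpair_classes_def nonzero_eigenpair_classes_def by metis
  with count show "real (card (eigenpair_classes m S)) = ((real m - 1) ^ r - 1) / (real m - 2)"
    by simp
qed

end
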